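(* Let $k\ge 3$ be an integer and let $E: a_1x_1+\dots+a_kx_k=0$ be a linear equation with coefficients $a_i\in\mathbb{Z}\setminus\{0\}$ for each $i=1,\dots,k$. If $E$ is $2$-uncommon over the integers, then $E$ is also $r$-uncommon over the integers for every integer $r\ge 3$.
   Context: Write $[n]=\{1,\dots,n\}$. Let $E: a_1x_1+\dots+a_kx_k=0$ be a linear equation with nonzero integer coefficients, and let $r\ge 2$ be an integer. An $r$-coloring of $[n]$ is a map $c:[n]\to\{1,\dots,r\}$; a solution $(x_1,\dots,x_k)\in[n]^k$ of $E$ is monochromatic if $c(x_1)=\dots=c(x_k)$. The equation $E$ is $r$-common over the integers if any $r$-coloring of $[n]$ has at least as many monochromatic solutions asymptotically (as $n\to\infty$) as a uniformly random $r$-coloring; that is, the minimum over all $r$-colorings of $[n]$ of the proportion of solutions of $E$ in $[n]^k$ that are monochromatic is at least $r^{1-k}-o(1)$ as $n\to\infty$. Otherwise $E$ is $r$-uncommon over the integers. *)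

theory Defs
  imports "HOL-Analysis.Analysis" "HOL-Library.Landau_Symbols"
begin

text \<open>
  The equation \<open>a\<^sub>1 x\<^sub>1 + \<dots> + a\<^sub>k x\<^sub>k = 0\<close> is given by the number \<open>k\<close> of variables and a coefficient
  function \<open>a\<close>, of which only the values on \<open>{1..k}\<close> matter. Tuples in \<open>[n]\<^sup>k\<close> and colorings of
  \<open>[n]\<close> are extensional functions, so that they can be counted and range over finite sets.
\<close>

definition solutions :: "nat \<Rightarrow> (nat \<Rightarrow> int) \<Rightarrow> nat \<Rightarrow> (nat \<Rightarrow> nat) set" where
  "solutions k a n = {x \<in> {1..k} \<rightarrow>\<^sub>E {1..n}. (\<Sum>i=1..k. a i * int (x i)) = 0}"

definition colorings :: "nat \<Rightarrow> nat \<Rightarrow> (nat \<Rightarrow> nat) set" where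
  "colorings r n = {1..n} \<rightarrow>\<^sub>E {1..r}"

definition mono_solutions ::
    "nat \<Rightarrow> (nat \<Rightarrow> int) \<Rightarrow> nat \<Rightarrow> (nat \<Rightarrow> nat) \<Rightarrow> (nat \<Rightarrow> nat) set" where
  "mono_solutions k a n c =
     {x \<in> solutions k a n. \<forall>i\<in>{1..k}. \<forall>j\<in>{1..k}. c (x i) = c (x j)}"

text \<open>
  If there are no solutions in \<open>[n]\<^sup>k\<close> (for example, if all coefficients have the same sign), every
  coloring trivially has at least as many monochromatic solutions as a random one. The proportion
  is therefore set to \<open>1\<close> in this case, rather than to the value \<open>0 / 0 = 0\<close> of HOL.
\<close>

definition mono_proportion :: "nat \<Rightarrow> (nat \<Rightarrow> int) \<Rightarrow> nat \<Rightarrow> (nat \<Rightarrow> nat) \<Rightarrow> real" where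
  "mono_proportion k a n c =
     (if solutions k a n = {} then 1
      else real (card (mono_solutions k a n c)) / real (card (solutions k a n)))"

definition min_mono_proportion :: "nat \<Rightarrow> nat \<Rightarrow> (nat \<Rightarrow> int) \<Rightarrow> nat \<Rightarrow> real" where
  "min_mono_proportion r k a n = Min (mono_proportion k a n ` colorings r n)"

definition common_over_integers :: "nat \<Rightarrow> nat \<Rightarrow> (nat \<Rightarrow> int) \<Rightarrow> bool" where
  "common_over_integers r k a \<longleftrightarrow>
     (\<exists>\<delta> :: nat \<Rightarrow> real. \<delta> \<in> o(\<lambda>_. 1) \<and>
        (\<forall>n. min_mono_proportion r k a n \<ge> real r powi (1 - int k) - \<delta> n))"

definition uncommon_over_integers :: "nat \<Rightarrow> nat \<Rightarrow> (nat \<Rightarrow> int) \<Rightarrow> bool" where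
  "uncommon_over_integers r k a \<longleftrightarrow> \<not> common_over_integers r k a"

lemma finite_solutions: "finite (solutions k a n)"
  unfolding solutions_def by (rule finite_subset[OF _ finite_PiE[of "{1..k}" "\<lambda>_. {1..n}"]]) auto

lemma finite_colorings: "finite (colorings r n)"
  unfolding colorings_def by (intro finite_PiE) auto

lemma colorings_nonempty: "r \<ge> 1 \<Longrightarrow> colorings r n \<noteq> {}"
  unfolding colorings_def by (simp add: PiE_eq_empty_iff)

end

theory Submission
  imports Defs
begin

text \<open>
  Given a 2-coloring \<open>c\<close>, give each integer independently a uniform label in \<open>{1..r}\<close>, and
  recolor it by \<open>c\<close> if the label is at most 2 and by its label otherwise. A solution with distinct
  entries becomes monochromatic with probability \<open>(r - 2) / r\<^sup>k\<close>, plus \<open>(2 / r)\<^sup>k\<close> if \<open>c\<close> is already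
  constant on it. Averaging, some \<open>r\<close>-coloring has a monochromatic proportion of at most
  \<open>(2 / r)\<^sup>k p + (r - 2) / r\<^sup>k\<close> plus the proportion of solutions with a repeated entry, where \<open>p\<close> is
  the proportion for \<open>c\<close>. For \<open>p = 2\<^bsup>1-k\<^esup>\<close> the first two terms add up to \<open>r\<^bsup>1-k\<^esup>\<close>, and the
  last one tends to 0: it is \<open>O(n\<^bsup>k-2\<^esup>) / \<Omega>(n\<^bsup>k-1\<^esup>)\<close> unless all coefficients have the same sign.
\<close>

section \<open>Averaging over random recolorings\<close>

definition degenerate_solutions :: "nat \<Rightarrow> (nat \<Rightarrow> int) \<Rightarrow> nat \<Rightarrow> (nat \<Rightarrow> nat) set" where
  "degenerate_solutions k a n = {x \<in> solutions k a n. \<not> inj_on x {1..k}}"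

definition recolor :: "nat \<Rightarrow> (nat \<Rightarrow> nat) \<Rightarrow> (nat \<Rightarrow> nat) \<Rightarrow> nat \<Rightarrow> nat" where
  "recolor n c g = (\<lambda>v\<in>{1..n}. if g v \<le> 2 then c v else g v)"

lemma recolor_in_colorings:
  assumes "r \<ge> 2" "c \<in> colorings 2 n" "g \<in> colorings r n"
  shows "recolor n c g \<in> colorings r n"
  unfolding colorings_def
proof (rule PiE_I)
  fix v assume v: "v \<in> {1..n}"
  have "c v \<in> {1..2}" "g v \<in> {1..r}"
    using assms v unfolding colorings_def by blast+
  then show "recolor n c g v \<in> {1..r}"
    using v assms(1) by (auto simp: recolor_def)
qed (auto simp: recolor_def)

lemma card_colorings: "card (colorings r n) = r ^ n"
  by (simp add: colorings_def card_PiE)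

text \<open>Independence of the labels: a uniform labeling sends all of \<open>X\<close> into
  \<open>Q\<close> with probability \<open>(card Q / r) ^ card X\<close>. The denominators are
  cleared so that the count stays in the naturals.\<close>

lemma card_colorings_into:
  assumes "X \<subseteq> {1..n}" "Q \<subseteq> {1..r}"
  shows "card {g \<in> colorings r n. \<forall>v\<in>X. g v \<in> Q} * r ^ card X = card Q ^ card X * r ^ n"
proof -
  have "{g \<in> colorings r n. \<forall>v\<in>X. g v \<in> Q} = (\<Pi>\<^sub>E v\<in>{1..n}. if v \<in> X then Q else {1..r})"
  proof (rule set_eqI)
    fix g
    show "g \<in> {g \<in> colorings r n. \<forall>v\<in>X. g v \<in> Q}
        \<longleftrightarrow> g \<in> (\<Pi>\<^sub>E v\<in>{1..n}. if v \<in> X then Q else {1..r})"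
      using assms unfolding colorings_def mem_Collect_eq PiE_iff by (smt (verit) subsetD)
  qed
  then have "card {g \<in> colorings r n. \<forall>v\<in>X. g v \<in> Q}
      = (\<Prod>v\<in>{1..n}. if v \<in> X then card Q else r)"
    by (simp add: card_PiE if_distrib cong: if_cong)
  also have "\<dots> = card Q ^ card X * r ^ card ({1..n} - X)"
    using assms(1) by (simp add: prod.If_cases Int_absorb1 Diff_eq)
  also have "card ({1..n} - X) = n - card X"
    using assms(1) by (simp add: card_Diff_subset finite_subset)
  finally show ?thesis
    using card_mono[OF _ assms(1)] by (simp flip: power_add)
qed

text \<open>Recolored entries with labels at most 2 have colors at most 2, and all others keep a
  label of at least 3. So a solution can become monochromatic only if all its labels are small and
  \<open>c\<close> is constant on it, or if all its labels equal one \<open>q\<close> in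
  \<open>{3..r}\<close>. The union bound over these events has \<open>1 + (r - 2)\<close>
  terms.\<close>

lemma card_recolorings_mono_le:
  assumes "k \<ge> 1" "r \<ge> 2" "c \<in> colorings 2 n" "x \<in> solutions k a n" "inj_on x {1..k}"
  shows "card {g \<in> colorings r n. x \<in> mono_solutions k a n (recolor n c g)} * r ^ k
    \<le> (2 ^ k * of_bool (x \<in> mono_solutions k a n c) + (r - 2)) * r ^ n"
proof -
  define X where "X = x ` {1..k}"
  define G where "G Q = {g \<in> colorings r n. \<forall>v\<in>X. g v \<in> Q}" for Q
  \<comment> \<open>The event that \<open>c\<close> decides all colors of the entries; it
    contributes only if \<open>c\<close> is already constant on \<open>x\<close>.\<close>
  define N where "N = (if x \<in> mono_solutions k a n c then G {1..2} else {})"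
  have xn: "x i \<in> {1..n}" if "i \<in> {1..k}" for i
    using assms(4) that unfolding solutions_def by blast
  \<comment> \<open>Distinctness of the entries enters here: the solution carries \<open>k\<close>
    independent labels.\<close>
  have cX: "card X = k"
    using assms(5) by (simp add: X_def card_image)
  have card_G: "card (G Q) * r ^ k = card Q ^ k * r ^ n" if "Q \<subseteq> {1..r}" for Q
  proof -
    have "X \<subseteq> {1..n}"
      unfolding X_def using xn by (rule image_subsetI)
    from card_colorings_into[OF this that] show ?thesis
      by (simp add: G_def cX)
  qed
  have fin: "finite (G Q)" for Q
    by (simp add: G_def finite_colorings)
  have "{g \<in> colorings r n. x \<in> mono_solutions k a n (recolor n c g)} \<subseteq> N \<union> (\<Union>q\<in>{3..r}. G {q})"
  proof
    fix g assume "g \<in> {g \<in> colorings r n. x \<in> mono_solutions k a n (recolor n c g)}"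
    then have g: "g \<in> colorings r n"
      and mono: "\<And>i j. i \<in> {1..k} \<Longrightarrow> j \<in> {1..k} \<Longrightarrow> recolor n c g (x i) = recolor n c g (x j)"
      unfolding mono_solutions_def by blast+
    have rec: "recolor n c g (x i) = (if g (x i) \<le> 2 then c (x i) else g (x i))"
      if "i \<in> {1..k}" for i
      using xn[OF that] by (simp add: recolor_def)
    have c2: "c (x i) \<le> 2" and g1: "g (x i) \<in> {1..r}" if "i \<in> {1..k}" for i
      using PiE_mem[OF assms(3)[unfolded colorings_def] xn[OF that]]
        PiE_mem[OF g[unfolded colorings_def] xn[OF that]] by simp_all
    have one: "1 \<in> {1..k}"
      using assms(1) by simp
    show "g \<in> N \<union> (\<Union>q\<in>{3..r}. G {q})"
    proof (cases "g (x 1) \<le> 2")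
      case True
      \<comment> \<open>A label of at least 3 at another entry would be its new color, whereas the
        first entry has color \<open>c (x 1)\<close>, which is at most 2.\<close>
      have small: "g (x i) \<le> 2" if "i \<in> {1..k}" for i
        using mono[OF that one] rec[OF that] rec[OF one] c2[OF one] True by (auto split: if_splits)
      then have "c (x i) = c (x j)" if "i \<in> {1..k}" "j \<in> {1..k}" for i j
        using mono[OF that] rec that by simp
      then have "x \<in> mono_solutions k a n c"
        using assms(4) unfolding mono_solutions_def by blast
      moreover have "g (x i) \<in> {1..2}" if "i \<in> {1..k}" for i
        using small[OF that] g1[OF that] by simp
      then have "g \<in> G {1..2}"
        using g unfolding G_def X_def by blast
      ultimately show ?thesis
        by (simp add: N_def)
    next
      case False
      have "g (x i) = g (x 1)" if "i \<in> {1..k}" for i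
        using mono[OF that one] rec[OF that] rec[OF one] c2[OF that] False by (auto split: if_splits)
      then have "g \<in> G {g (x 1)}"
        using g unfolding G_def X_def by blast
      moreover have "g (x 1) \<in> {3..r}"
        using g1[OF one] False by simp
      ultimately show ?thesis
        by blast
    qed
  qed
  then have "card {g \<in> colorings r n. x \<in> mono_solutions k a n (recolor n c g)}
      \<le> card (N \<union> (\<Union>q\<in>{3..r}. G {q}))"
    by (intro card_mono) (auto simp: N_def fin)
  also have "\<dots> \<le> card N + (\<Sum>q\<in>{3..r}. card (G {q}))"
    by (intro order_trans[OF card_Un_le] add_left_mono card_UN_le) simp
  finally have "card {g \<in> colorings r n. x \<in> mono_solutions k a n (recolor n c g)} * r ^ k
      \<le> (card N + (\<Sum>q\<in>{3..r}. card (G {q}))) * r ^ k"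
    by simp
  also have "\<dots> = card N * r ^ k + (\<Sum>q\<in>{3..r}. card (G {q}) * r ^ k)"
    by (simp add: distrib_right sum_distrib_right)
  also have "(\<Sum>q\<in>{3..r}. card (G {q}) * r ^ k) = (\<Sum>q\<in>{3..r}. r ^ n)"
    by (intro sum.cong) (auto simp: card_G)
  also have "card N * r ^ k = 2 ^ k * of_bool (x \<in> mono_solutions k a n c) * r ^ n"
    using card_G[of "{1..2}"] assms(2) by (simp add: N_def)
  finally show ?thesis
    by (simp add: algebra_simps)
qed

text \<open>Double counting of pairs of a labeling and a solution that it makes monochromatic. Every
  recoloring is an \<open>r\<close>-coloring, so the minimum bounds each of their proportions from
  below, hence also the average. Degenerate solutions are estimated by the trivial probability
  1.\<close>

lemma min_mono_proportion_le:
  assumes "k \<ge> 1" "r \<ge> 2" "c \<in> colorings 2 n" "solutions k a n \<noteq> {}"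
  shows "min_mono_proportion r k a n \<le> (2 / real r) ^ k * mono_proportion k a n c
    + (real r - 2) / real r ^ k
    + real (card (degenerate_solutions k a n)) / real (card (solutions k a n))"
proof -
  define S where "S = solutions k a n"
  define T where "T = degenerate_solutions k a n"
  define M where "M = mono_solutions k a n c"
  define p where "p = min_mono_proportion r k a n"
  \<comment> \<open>\<open>h x / r ^ n\<close> is the probability that the recoloring makes
    \<open>x\<close> monochromatic.\<close>
  define h where "h x = card {g \<in> colorings r n. x \<in> mono_solutions k a n (recolor n c g)}" for x
  have fS: "finite S"
    by (simp add: S_def finite_solutions)
  have TS: "T \<subseteq> S"
    by (auto simp: S_def T_def degenerate_solutions_def)
  have MS: "M \<subseteq> S"
    by (auto simp: S_def M_def mono_solutions_def)
  have cS: "real (card S) > 0"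
    using assms(4) fS by (simp add: S_def card_gt_0_iff)
  have r0: "real r > 0"
    using assms(2) by simp
  have p_le: "p * card S \<le> card (mono_solutions k a n (recolor n c g))"
    if "g \<in> colorings r n" for g
  proof -
    have "p \<le> mono_proportion k a n (recolor n c g)"
      unfolding p_def min_mono_proportion_def
      using recolor_in_colorings[OF assms(2,3) that] finite_colorings by (intro Min_le) auto
    then show ?thesis
      using assms(4) cS by (simp add: mono_proportion_def S_def field_simps)
  qed
  have h_deg: "real (h x) \<le> real r ^ n" for x
  proof -
    have "h x \<le> card (colorings r n)"
      unfolding h_def by (intro card_mono finite_colorings) auto
    then show ?thesis
      by (simp add: card_colorings flip: of_nat_power)
  qed
  have h_inj: "real (h x) \<le> ((2 / r) ^ k * of_bool (x \<in> M) + (real r - 2) / r ^ k) * real r ^ n"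
    if "x \<in> S - T" for x
  proof -
    have "h x * r ^ k \<le> (2 ^ k * of_bool (x \<in> M) + (r - 2)) * r ^ n"
      unfolding h_def M_def using that assms
      by (intro card_recolorings_mono_le) (auto simp: S_def T_def degenerate_solutions_def)
    then have "real (h x * r ^ k) \<le> real ((2 ^ k * of_bool (x \<in> M) + (r - 2)) * r ^ n)"
      by (rule of_nat_mono)
    then have "real (h x) * r ^ k \<le> (2 ^ k * of_bool (x \<in> M) + (real r - 2)) * real r ^ n"
      using assms(2) by (simp add: of_nat_diff add_diff_eq)
    then have "real (h x) \<le> (2 ^ k * of_bool (x \<in> M) + (real r - 2)) * real r ^ n / r ^ k"
      using r0 by (subst pos_le_divide_eq) simp_all
    also have "\<dots> = ((2 / r) ^ k * of_bool (x \<in> M) + (real r - 2) / r ^ k) * real r ^ n"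
      by (simp add: power_divide add_divide_distrib distrib_right)
    finally show ?thesis .
  qed
  have nonneg: "(2 / r) ^ k * of_bool (x \<in> M) + (real r - 2) / r ^ k \<ge> 0" for x
    using assms(2) by simp
  have "p * card S * real r ^ n = (\<Sum>g\<in>colorings r n. p * card S)"
    by (simp add: card_colorings)
  also have "\<dots> \<le> (\<Sum>g\<in>colorings r n. real (card (mono_solutions k a n (recolor n c g))))"
    by (intro sum_mono p_le)
  also have "\<dots> = (\<Sum>g\<in>colorings r n. \<Sum>x\<in>S. of_bool (x \<in> mono_solutions k a n (recolor n c g)))"
    using fS by (intro sum.cong) (auto simp: mono_solutions_def S_def intro!: arg_cong[where f = card])
  also have "\<dots> = (\<Sum>x\<in>S. real (h x))"
    by (subst sum.swap) (simp add: h_def finite_colorings Int_def)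
  also have "\<dots> \<le> (\<Sum>x\<in>S. ((2 / r) ^ k * of_bool (x \<in> M) + (real r - 2) / r ^ k) * real r ^ n
      + of_bool (x \<in> T) * real r ^ n)"
  \<comment> \<open>On \<open>T\<close> the last summand alone suffices, since the first is
    nonnegative; off \<open>T\<close> the bound for distinct entries applies.\<close>
  proof (rule sum_mono)
    fix x assume "x \<in> S"
    then show "real (h x) \<le> ((2 / r) ^ k * of_bool (x \<in> M) + (real r - 2) / r ^ k) * real r ^ n
      + of_bool (x \<in> T) * real r ^ n"
      using add_mono[OF mult_nonneg_nonneg[OF nonneg[of x], of "real r ^ n"] h_deg[of x]] h_inj[of x]
      by (cases "x \<in> T") simp_all
  qed
  also have "\<dots> = ((2 / r) ^ k * (\<Sum>x\<in>S. of_bool (x \<in> M)) + card S * ((real r - 2) / r ^ k)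
      + (\<Sum>x\<in>S. of_bool (x \<in> T))) * real r ^ n"
    by (simp only: sum.distrib sum_distrib_left sum_distrib_right distrib_right sum_constant)
  also have "\<dots> = ((2 / r) ^ k * card M + card S * ((real r - 2) / r ^ k) + card T) * real r ^ n"
    using fS TS MS by (simp add: Int_absorb1 Int_absorb2)
  finally have "p * card S \<le> (2 / r) ^ k * card M + card S * ((real r - 2) / r ^ k) + card T"
    using r0 by simp
  then have "p \<le> ((2 / r) ^ k * card M + card S * ((real r - 2) / r ^ k) + card T) / card S"
    using cS by (simp add: pos_le_divide_eq)
  also have "\<dots> = (2 / r) ^ k * (card M / card S) + (real r - 2) / r ^ k + card T / card S"
    using cS by (simp add: add_divide_distrib)
  finally show ?thesis
    using assms(4) by (simp add: p_def mono_proportion_def S_def M_def T_def)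
qed

section \<open>Few degenerate solutions, many solutions in total\<close>

text \<open>Two coordinates are redundant: \<open>x i\<close> is copied from \<open>x j\<close>, and
  then the equation determines \<open>x l\<close> because \<open>a l\<close> is nonzero. The
  remaining \<open>k - 2\<close> coordinates give an injection.\<close>

lemma card_solutions_eq_entries_le:
  assumes "i \<in> {1..k}" "j \<in> {1..k}" "l \<in> {1..k}" "i \<noteq> j" "l \<noteq> i" "l \<noteq> j" "a l \<noteq> 0"
  shows "card {x \<in> solutions k a n. x i = x j} \<le> n ^ (k - 2)"
proof -
  define I where "I = {1..k} - {i, l}"
  have "card {x \<in> solutions k a n. x i = x j} \<le> card (I \<rightarrow>\<^sub>E {1..n})"
  proof (rule card_inj_on_le[where f = "\<lambda>x. restrict x I"])
    show "inj_on (\<lambda>x. restrict x I) {x \<in> solutions k a n. x i = x j}"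
    proof (rule inj_onI)
      fix x y
      assume x: "x \<in> {x \<in> solutions k a n. x i = x j}" and y: "y \<in> {x \<in> solutions k a n. x i = x j}"
        and eq: "restrict x I = restrict y I"
      have I: "x t = y t" if "t \<in> I" for t
        using fun_cong[OF eq, of t] that by simp
      have "x i = y i"
        using I[of j] x y assms by (simp add: I_def)
      with I have off: "x t = y t" if "t \<in> {1..k} - {l}" for t
        using that by (auto simp: I_def)
      have "a l * int (x l) + (\<Sum>t\<in>{1..k} - {l}. a t * int (x t))
          = a l * int (y l) + (\<Sum>t\<in>{1..k} - {l}. a t * int (y t))"
        using x y sum.remove[OF finite_atLeastAtMost assms(3), of "\<lambda>t. a t * int (x t)"]
          sum.remove[OF finite_atLeastAtMost assms(3), of "\<lambda>t. a t * int (y t)"]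
        by (simp add: solutions_def)
      then have "x l = y l"
        using off assms(7) by simp
      with off show "x = y"
        using x y by (intro PiE_ext[of x "{1..k}" "\<lambda>_. {1..n}"]) (auto simp: solutions_def)
    qed
    show "(\<lambda>x. restrict x I) ` {x \<in> solutions k a n. x i = x j} \<subseteq> I \<rightarrow>\<^sub>E {1..n}"
    proof (rule image_subsetI)
      fix x assume "x \<in> {x \<in> solutions k a n. x i = x j}"
      then have "x t \<in> {1..n}" if "t \<in> I" for t
        using that unfolding solutions_def I_def by blast
      then show "restrict x I \<in> I \<rightarrow>\<^sub>E {1..n}"
        unfolding restrict_PiE_iff by blast
    qed
  qed (auto intro: finite_PiE simp: I_def)
  also have "\<dots> = n ^ card I"
    by (simp add: card_PiE I_def)
  also have "card I = k - 2"
    using assms by (simp add: I_def card_Diff_subset)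
  finally show ?thesis .
qed

text \<open>A union bound over the pairs of indices at which the entries agree, of which there are
  at most \<open>k\<^sup>2\<close>.\<close>

lemma card_degenerate_solutions_le:
  assumes "k \<ge> 3" "\<forall>i\<in>{1..k}. a i \<noteq> 0"
  shows "card (degenerate_solutions k a n) \<le> k\<^sup>2 * n ^ (k - 2)"
proof -
  define P where "P = {1..k} \<times> {1..k} - Id"
  define E where "E = (\<lambda>(i, j). {x \<in> solutions k a n. x i = x j})"
  have "degenerate_solutions k a n \<subseteq> (\<Union>p\<in>P. E p)"
    by (auto simp: degenerate_solutions_def inj_on_def P_def E_def)
  then have "card (degenerate_solutions k a n) \<le> card (\<Union>p\<in>P. E p)"
    by (intro card_mono) (auto simp: P_def E_def finite_solutions)
  also have "\<dots> \<le> (\<Sum>p\<in>P. card (E p))"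
    by (intro card_UN_le) (simp add: P_def)
  also have "\<dots> \<le> (\<Sum>p\<in>P. n ^ (k - 2))"
  proof (rule sum_mono)
    fix p assume "p \<in> P"
    then obtain i j where p: "p = (i, j)" "i \<in> {1..k}" "j \<in> {1..k}" "i \<noteq> j"
      by (cases p) (auto simp: P_def)
    \<comment> \<open>Since \<open>k\<close> is at least 3, there is a third index at which to solve
      the equation.\<close>
    have "\<not> {1..k} \<subseteq> {i, j}"
      using p assms(1) card_mono[of "{i, j}" "{1..k}"] by auto
    then obtain l where "l \<in> {1..k}" "l \<noteq> i" "l \<noteq> j"
      by blast
    then show "card (E p) \<le> n ^ (k - 2)"
      using p assms(2) card_solutions_eq_entries_le[of i k j l a n] by (simp add: E_def)
  qed
  also have "\<dots> = card P * n ^ (k - 2)"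
    by simp
  also have "card P \<le> card ({1..k} \<times> {1..k})"
    by (intro card_mono) (auto simp: P_def)
  then have "card P * n ^ (k - 2) \<le> k\<^sup>2 * n ^ (k - 2)"
    by (simp add: power2_eq_square)
  finally show ?thesis .
qed

text \<open>
  With \<open>a i = A > 0 > a j = - B\<close>, the solutions counted here have \<open>x l = A B y l\<close> for \<open>l\<close> other than
  \<open>i\<close> and \<open>j\<close>, and \<open>x i = B u\<close>, \<open>x j = A (u + s)\<close> where \<open>s = \<Sum> a l y l\<close>. The shift
  \<open>u = y i + C m\<close> keeps \<open>u + s\<close> positive.
\<close>

lemma card_solutions_ge:
  fixes k :: nat and a :: "nat \<Rightarrow> int"
  defines "C \<equiv> nat (\<Sum>l=1..k. \<bar>a l\<bar>)"
  assumes "i \<in> {1..k}" "j \<in> {1..k}" "a i > 0" "a j < 0" "C\<^sup>2 * (1 + 2 * C) * m \<le> n"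
  shows "m ^ (k - 1) \<le> card (solutions k a n)"
proof -
  define A B where "A = nat (a i)" and "B = nat (- a j)"
  define J where "J = {1..k} - {i, j}"
  define s where "s y = (\<Sum>l\<in>J. a l * int (y l))" for y :: "nat \<Rightarrow> nat"
  \<comment> \<open>The truncation by \<open>nat\<close> is harmless on \<open>D\<close>: there
    \<open>s y\<close> is at least \<open>- C * m\<close> and \<open>y i\<close> is at least
    1.\<close>
  define v where "v y = nat (int (y i) + int (C * m) + s y)" for y
  define f where "f y = (\<lambda>l\<in>{1..k}. if l = i then B * (y i + C * m)
    else if l = j then A * v y else A * B * y l)" for y
  \<comment> \<open>The free parameters are all coordinates except \<open>j\<close>, which gives the
    exponent \<open>k - 1\<close>.\<close>
  define D where "D = {1..k} - {j} \<rightarrow>\<^sub>E {1..m}"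
  have ij: "i \<noteq> j"
    using assms by auto
  have AB: "int A = a i" "int B = - a j" "A > 0" "B > 0"
    using assms by (auto simp: A_def B_def)
  have C: "int C = (\<Sum>l=1..k. \<bar>a l\<bar>)"
    by (simp add: C_def sum_nonneg)
  have le_C: "\<bar>a l\<bar> \<le> int C" if "l \<in> {1..k}" for l
    unfolding C using that by (intro member_le_sum) auto
  have AC: "A \<le> C" and BC: "B \<le> C"
    using le_C[of i] le_C[of j] assms AB by auto
  have C1: "C \<ge> 1"
    using AC AB by simp
  have s_le: "\<bar>s y\<bar> \<le> int (C * m)" if "y \<in> D" for y
  proof -
    have "\<bar>s y\<bar> \<le> (\<Sum>l\<in>J. \<bar>a l * int (y l)\<bar>)"
      unfolding s_def by (rule sum_abs)
    also have "\<dots> \<le> (\<Sum>l\<in>J. \<bar>a l\<bar> * int m)"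
    proof (rule sum_mono)
      fix l assume "l \<in> J"
      then have "y l \<in> {1..m}"
        using that unfolding D_def J_def by blast
      then show "\<bar>a l * int (y l)\<bar> \<le> \<bar>a l\<bar> * int m"
        by (simp add: abs_mult mult_left_mono)
    qed
    also have "\<dots> \<le> (\<Sum>l=1..k. \<bar>a l\<bar> * int m)"
      by (intro sum_mono2) (auto simp: J_def)
    also have "\<dots> = int (C * m)"
      by (simp add: C sum_distrib_right)
    finally show ?thesis .
  qed
  have y_bd: "y l \<in> {1..m}" if "y \<in> D" "l \<in> {1..k} - {j}" for y l
    using that unfolding D_def by blast
  have v: "int (v y) = int (y i) + int (C * m) + s y" "1 \<le> v y" "v y \<le> (1 + 2 * C) * m"
    if "y \<in> D" for y
  proof -
    have "1 \<le> y i" "y i \<le> m"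
      using y_bd[OF that, of i] assms ij by auto
    moreover have "- int (C * m) \<le> s y" "s y \<le> int (C * m)"
      using s_le[OF that] by linarith+
    ultimately show "int (v y) = int (y i) + int (C * m) + s y" "1 \<le> v y" "v y \<le> (1 + 2 * C) * m"
      unfolding v_def by (auto simp: algebra_simps nat_le_iff)
  qed
  \<comment> \<open>Source of the constant in the hypothesis on \<open>n\<close>: each entry of
    \<open>f y\<close> is a coefficient factor of at most \<open>C\<^sup>2\<close> times a number of
    at most \<open>(1 + 2 * C) * m\<close>.\<close>
  have bound: "t * u \<le> n" if "t \<le> C\<^sup>2" "u \<le> (1 + 2 * C) * m" for t u
    using mult_le_mono[OF that] assms(6) unfolding mult.assoc by (rule order_trans)
  have CC: "C \<le> C\<^sup>2"
    using C1 by (simp add: power2_eq_square)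
  have ABC: "A * B \<le> C\<^sup>2"
    using mult_le_mono[OF AC BC] by (simp add: power2_eq_square)
  have range: "f y l \<in> {1..n}" if "y \<in> D" and l: "l \<in> {1..k}" for y l
  proof -
    consider "l = i" | "l = j" | "l \<in> J"
      using l unfolding J_def by blast
    then show ?thesis
    proof cases
      case 1
      have "y i \<in> {1..m}"
        using y_bd[OF that(1), of i] assms ij by auto
      then have "y i + C * m \<le> (1 + 2 * C) * m" "y i > 0"
        by (simp_all add: distrib_right)
      then have "B * (y i + C * m) \<le> n"
        using BC CC by (intro bound) simp_all
      then show ?thesis
        using that 1 AB \<open>y i > 0\<close> by (simp add: f_def Suc_le_eq)
    next
      case 2
      have "A * v y \<le> n"
        using AC CC v[OF that(1)] by (intro bound) auto
      then show ?thesis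
        using that 2 ij v(2)[OF that(1)] AB by (simp add: f_def Suc_le_eq)
    next
      case 3
      then have yl: "y l \<in> {1..m}"
        using y_bd[OF that(1), of l] by (auto simp: J_def)
      then have "A * B * y l \<le> n"
        using ABC by (intro bound) (simp_all add: distrib_right)
      then show ?thesis
        using that 3 yl AB by (simp add: f_def J_def Suc_le_eq)
    qed
  qed
  have sol: "f y \<in> solutions k a n" if "y \<in> D" for y
  proof -
    have "(\<Sum>l=1..k. a l * int (f y l)) = a i * int (f y i) + a j * int (f y j)
        + (\<Sum>l\<in>J. a l * int (f y l))"
    proof -
      have "{1..k} = insert i (insert j J)" "finite J" "i \<notin> insert j J" "j \<notin> J"
        using assms(2,3) ij by (auto simp: J_def)
      then show ?thesis
        by (simp only: sum.insert finite_insert add.assoc simp_thms)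
    qed
    also have "(\<Sum>l\<in>J. a l * int (f y l)) = int A * int B * s y"
      unfolding s_def sum_distrib_left by (intro sum.cong) (auto simp: f_def J_def)
    also have "a i * int (f y i) + a j * int (f y j)
        = int A * int B * (int (y i) + int (C * m)) - int B * int A * int (v y)"
      using assms(2,3) ij AB by (simp add: f_def)
    finally have "(\<Sum>l=1..k. a l * int (f y l)) = 0"
      using v(1)[OF that] by (simp add: algebra_simps)
    then show ?thesis
      using range[OF that] by (auto simp: solutions_def f_def)
  qed
  \<comment> \<open>The multipliers \<open>B\<close> and \<open>A * B\<close> are positive and the
    shift \<open>C * m\<close> is the same for all \<open>y\<close>, so each entry of
    \<open>f y\<close> other than the one at \<open>j\<close> recovers the coordinate of
    \<open>y\<close> there.\<close>
  have "inj_on f D"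
  proof (rule inj_onI)
    fix y z assume y: "y \<in> D" and z: "z \<in> D" and eq: "f y = f z"
    show "y = z"
    proof (rule PiE_ext)
      show "y \<in> {1..k} - {j} \<rightarrow>\<^sub>E {1..m}" "z \<in> {1..k} - {j} \<rightarrow>\<^sub>E {1..m}"
        using y z by (simp_all add: D_def)
    next
      fix l assume "l \<in> {1..k} - {j}"
      then show "y l = z l"
        using fun_cong[OF eq, of l] AB(3,4) by (auto simp: f_def split: if_splits)
    qed
  qed
  then have "card D \<le> card (solutions k a n)"
    using sol by (intro card_inj_on_le[of f]) (auto simp: finite_solutions)
  then show ?thesis
    using assms(3) by (simp add: D_def card_PiE)
qed

lemma degenerate_proportion_tendsto_0:
  assumes "k \<ge> 3" "\<forall>l\<in>{1..k}. a l \<noteq> 0"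
    and "i \<in> {1..k}" "j \<in> {1..k}" "a i > 0" "a j < 0"
  shows "(\<lambda>n. real (card (degenerate_solutions k a n)) / real (card (solutions k a n))) \<longlonglongrightarrow> 0"
proof -
  define C where "C = nat (\<Sum>l=1..k. \<bar>a l\<bar>)"
  define d where "d = C\<^sup>2 * (1 + 2 * C)"
  \<comment> \<open>The number of solutions will be at least \<open>(n / (2 * d)) ^ (k - 1)\<close>;
    dividing \<open>k\<^sup>2 * n ^ (k - 2)\<close> by this leaves \<open>K / n\<close>.\<close>
  define K where "K = real k ^ 2 * (2 * real d) ^ (k - 1)"
  have "\<bar>a i\<bar> \<le> (\<Sum>l=1..k. \<bar>a l\<bar>)"
    using assms(3) by (intro member_le_sum) auto
  then have "C > 0"
    using assms(5) by (simp add: C_def)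
  then have d: "d > 0"
    by (simp add: d_def)
  have le: "real (card (degenerate_solutions k a n)) / real (card (solutions k a n)) \<le> K / real n"
    if "n \<ge> d" for n
  proof -
    define m where "m = n div d"
    have m: "m > 0"
      using that d by (simp add: m_def div_greater_zero_iff)
    have n: "n > 0"
      using that d by simp
    have "d * m \<le> n"
      by (simp add: m_def)
    then have lower: "m ^ (k - 1) \<le> card (solutions k a n)"
      using card_solutions_ge[of i k j a m n] assms by (simp add: C_def d_def)
    have "n = d * m + n mod d"
      by (simp add: m_def)
    \<comment> \<open>Rounding down in \<open>n div d\<close> costs at most a factor of 2: the
      remainder is below \<open>d\<close>, and \<open>m\<close> is positive.\<close>
    also have "\<dots> \<le> d * m + d * m"
      using m d mod_less_divisor[OF d, of n] mult_le_mono2[of 1 m d] by linarith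
    finally have "n ^ (k - 1) \<le> (2 * d * m) ^ (k - 1)"
      by (intro power_mono) auto
    also have "\<dots> \<le> (2 * d) ^ (k - 1) * card (solutions k a n)"
      using lower by (simp add: power_mult_distrib)
    finally have upper: "n ^ (k - 1) \<le> (2 * d) ^ (k - 1) * card (solutions k a n)" .
    have "card (degenerate_solutions k a n) * n \<le> k\<^sup>2 * n ^ (k - 2) * n"
      using card_degenerate_solutions_le[OF assms(1,2)] by simp
    also have "k\<^sup>2 * n ^ (k - 2) * n = k\<^sup>2 * n ^ (k - 1)"
    proof -
      have "k - 1 = Suc (k - 2)"
        using assms(1) by simp
      then show ?thesis
        by simp
    qed
    also have "\<dots> \<le> k\<^sup>2 * ((2 * d) ^ (k - 1) * card (solutions k a n))"
      using upper by (rule mult_le_mono2)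
    finally have "real (card (degenerate_solutions k a n) * n)
        \<le> real (k\<^sup>2 * ((2 * d) ^ (k - 1) * card (solutions k a n)))"
      by (rule of_nat_mono)
    then have "real (card (degenerate_solutions k a n)) * n \<le> K * card (solutions k a n)"
      by (simp add: K_def mult.assoc)
    moreover have "card (solutions k a n) > 0"
      using lower m by (metis less_le_trans zero_less_power)
    ultimately show ?thesis
      using n by (simp add: field_simps)
  qed
  have "(\<lambda>n. K / real n) \<longlonglongrightarrow> 0"
    by (rule lim_const_over_n)
  moreover have "\<forall>\<^sub>F n in sequentially.
      norm (real (card (degenerate_solutions k a n)) / real (card (solutions k a n))) \<le> K / real n"
    using eventually_ge_at_top[of d] by eventually_elim (use le in auto)
  ultimately show ?thesis
    by (rule Lim_null_comparison[rotated])
qed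

section \<open>Transfer from \<open>r\<close> colors to 2 colors\<close>

lemma solutions_empty_if_same_sign:
  assumes "k \<ge> 1" "(\<forall>l\<in>{1..k}. a l > 0) \<or> (\<forall>l\<in>{1..k}. a l < 0)"
  shows "solutions k a n = {}"
proof -
  have "(\<Sum>l=1..k. a l * int (x l)) \<noteq> 0" if "x \<in> {1..k} \<rightarrow>\<^sub>E {1..n}" for x
  proof -
    have x: "x l > 0" if "l \<in> {1..k}" for l
      using PiE_mem[OF \<open>x \<in> _\<close> that] by simp
    have ne: "{1..k} \<noteq> {}"
      using assms(1) by simp
    show ?thesis
      using assms(2)
    proof
      assume "\<forall>l\<in>{1..k}. a l > 0"
      then have "(\<Sum>l=1..k. a l * int (x l)) > 0"
        using x ne by (intro sum_pos) auto
      then show ?thesis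
        by simp
    next
      assume "\<forall>l\<in>{1..k}. a l < 0"
      then have "(\<Sum>l=1..k. - (a l * int (x l))) > 0"
        using x ne by (intro sum_pos) (auto simp: mult_neg_pos)
      then show ?thesis
        by (simp add: sum_negf)
    qed
  qed
  then show ?thesis
    by (auto simp: solutions_def)
qed

lemma min_mono_proportion_no_solutions:
  assumes "r \<ge> 1" "solutions k a n = {}"
  shows "min_mono_proportion r k a n = 1"
proof -
  have "mono_proportion k a n ` colorings r n = {1}"
    using assms colorings_nonempty[of r n] by (auto simp: mono_proportion_def)
  then show ?thesis
    by (simp add: min_mono_proportion_def)
qed

lemma min_mono_proportion_attained:
  assumes "r \<ge> 1"
  obtains c where "c \<in> colorings r n" "min_mono_proportion r k a n = mono_proportion k a n c"
proof -
  have "min_mono_proportion r k a n \<in> mono_proportion k a n ` colorings r n"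
    unfolding min_mono_proportion_def
    using assms by (intro Min_in) (auto simp: finite_colorings colorings_nonempty)
  then show thesis
    using that by blast
qed

lemma random_proportion_eq:
  assumes "r \<ge> 1"
  shows "real r powi (1 - int k) = real r / real r ^ k"
  using assms by (simp add: power_int_diff)

lemma random_proportion_le_1:
  assumes "r \<ge> 1" "k \<ge> 1"
  shows "real r powi (1 - int k) \<le> 1"
  using assms self_le_power[of "real r" k] by (simp add: random_proportion_eq)

text \<open>The theorem in contrapositive form. The averaging bound, applied to a minimizing
  2-coloring and solved for its proportion, turns the lower bound for \<open>r\<close> colors into
  one for 2 colors.\<close>

lemma common_2_if_common:
  assumes "k \<ge> 3" "\<forall>l\<in>{1..k}. a l \<noteq> 0" "r \<ge> 2" "common_over_integers r k a"
  shows "common_over_integers 2 k a"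
proof (cases "(\<forall>l\<in>{1..k}. a l > 0) \<or> (\<forall>l\<in>{1..k}. a l < 0)")
  case True
  \<comment> \<open>Without solutions the proportion is 1 by convention, which is at least the
    random value.\<close>
  then have "min_mono_proportion 2 k a n = 1" for n
    using assms(1) by (intro min_mono_proportion_no_solutions solutions_empty_if_same_sign) auto
  then show ?thesis
    unfolding common_over_integers_def
    using random_proportion_le_1[of 2 k] assms(1) by (intro exI[of _ "\<lambda>_. 0"]) simp
next
  case False
  then obtain i j where ij: "i \<in> {1..k}" "j \<in> {1..k}" "a i > 0" "a j < 0"
    using assms(2) by (meson linorder_neqE)
  obtain \<delta> :: "nat \<Rightarrow> real" where \<delta>: "\<delta> \<in> o(\<lambda>_. 1)"
    and common: "\<And>n. min_mono_proportion r k a n \<ge> real r powi (1 - int k) - \<delta> n"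
    using assms(4) unfolding common_over_integers_def by blast
  define \<eta> where "\<eta> n = real (card (degenerate_solutions k a n)) / real (card (solutions k a n))" for n
  \<comment> \<open>The factor \<open>(r / 2) ^ k\<close> inverts the coefficient of the 2-color
    proportion in the averaging bound. The absolute value makes the error nonnegative, as the case
    of no solutions for a given \<open>n\<close> requires.\<close>
  define \<epsilon> where "\<epsilon> n = (real r / 2) ^ k * (\<bar>\<delta> n\<bar> + \<eta> n)" for n
  have "\<delta> \<longlonglongrightarrow> 0"
    using smalloD_tendsto[OF \<delta>] by simp
  moreover have "\<eta> \<longlonglongrightarrow> 0"
    unfolding \<eta>_def by (rule degenerate_proportion_tendsto_0[OF assms(1,2) ij])
  ultimately have "\<epsilon> \<longlonglongrightarrow> 0"
    unfolding \<epsilon>_def by (auto intro!: tendsto_eq_intros)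
  then have "\<epsilon> \<in> o(\<lambda>_. 1)"
    by (intro smalloI_tendsto) auto
  moreover have "min_mono_proportion 2 k a n \<ge> real 2 powi (1 - int k) - \<epsilon> n" for n
  proof (cases "solutions k a n = {}")
    case True
    have "\<epsilon> n \<ge> 0"
      by (simp add: \<epsilon>_def \<eta>_def)
    then show ?thesis
      using random_proportion_le_1[of 2 k] assms(1) True
      by (simp add: min_mono_proportion_no_solutions)
  next
    case False
    obtain c where c: "c \<in> colorings 2 n" "min_mono_proportion 2 k a n = mono_proportion k a n c"
      by (rule min_mono_proportion_attained[of 2]) auto
    define p where "p = mono_proportion k a n c"
    have r: "real r > 0"
      using assms(3) by simp
    have "real r / real r ^ k - \<bar>\<delta> n\<bar> \<le> (2 / r) ^ k * p + (real r - 2) / r ^ k + \<eta> n"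
      using min_mono_proportion_le[OF _ assms(3) c(1) False] common[of n] assms(1,3)
      by (simp add: \<eta>_def p_def random_proportion_eq)
    \<comment> \<open>The random value for \<open>r\<close> colors minus the contribution of the
      labels above 2 is \<open>2 / r ^ k\<close>; rescaled by \<open>(r / 2) ^ k\<close>, it becomes
      the random value \<open>2 / 2 ^ k\<close> for 2 colors.\<close>
    then have "2 / real r ^ k - (\<bar>\<delta> n\<bar> + \<eta> n) \<le> (2 / r) ^ k * p"
      by (simp add: diff_divide_distrib)
    then have "(real r / 2) ^ k * (2 / real r ^ k - (\<bar>\<delta> n\<bar> + \<eta> n)) \<le> (r / 2) ^ k * ((2 / r) ^ k * p)"
      by (intro mult_left_mono) auto
    also have "\<dots> = p"
      using r by (simp add: power_divide)
    finally have "2 / 2 ^ k - \<epsilon> n \<le> p"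
      using r by (simp add: \<epsilon>_def right_diff_distrib power_divide)
    then show ?thesis
      using c(2) random_proportion_eq[of 2 k] by (simp add: p_def)
  qed
  ultimately show ?thesis
    unfolding common_over_integers_def by blast
qed

theorem theorem1p3:
  fixes k :: nat and a :: "nat \<Rightarrow> int"
  assumes "k \<ge> 3"
    and "\<forall>i\<in>{1..k}. a i \<noteq> 0"
    and "uncommon_over_integers 2 k a"
  shows "\<forall>r::nat. r \<ge> 3 \<longrightarrow> uncommon_over_integers r k a"
proof (intro allI impI)
  fix r :: nat assume "r \<ge> 3"
  then show "uncommon_over_integers r k a"
    using common_2_if_common[OF assms(1,2), of r] assms(3) by (auto simp: uncommon_over_integers_def)
qed

end
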